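(* Let $G$ be a finite graph admitting a nowhere-zero $4$-flow. Then $G$ has a $3$-removable set $R\subseteq E(G)$ such that $|R|\le \frac{1}{6}|E(G)|$.
   Context: For an integer $k\ge 2$, a $k$-flow on an orientation $\vec{G}$ of a graph $G$ is a function $\psi\colon E(\vec{G})\to\mathbb{Z}$ such that at every vertex the sum of incoming flow values equals the sum of outgoing flow values, and $|\psi(z)|\le k-1$ for every arc $z$. It is a nowhere-zero $k$-flow ($k$-NZF) if moreover $\psi(z)\neq 0$ for all arcs $z$. A graph has a $k$-NZF if some orientation of it has one. A set $R\subseteq E(G)$ is called $k$-removable if $G-R$ (the graph obtained by deleting the edges of $R$) has a nowhere-zero $k$-flow. *)

theory Defs
  imports Complex_Main "Graph_Theory.Digraph"
begin

text \<open>
  Undirected multigraphs: parallel edges are distinct edges with the same set of ends,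
  and a loop is an edge with a single end.
\<close>

record ('v, 'e) multigraph =
  vertices :: "'v set"
  edges :: "'e set"
  ends :: "'e \<Rightarrow> 'v set"

locale finite_multigraph =
  fixes G :: "('v, 'e) multigraph"
  assumes finite_vertices: "finite (vertices G)"
    and finite_edges: "finite (edges G)"
    and ends_in_vertices: "e \<in> edges G \<Longrightarrow> ends G e \<subseteq> vertices G"
    and card_ends: "e \<in> edges G \<Longrightarrow> card (ends G e) = 1 \<or> card (ends G e) = 2"

definition delete_edges :: "('v, 'e) multigraph \<Rightarrow> 'e set \<Rightarrow> ('v, 'e) multigraph" where
  "delete_edges G R = G\<lparr>edges := edges G - R\<rparr>"

definition is_orientation :: "('v, 'e) pre_digraph \<Rightarrow> ('v, 'e) multigraph \<Rightarrow> bool" where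
  "is_orientation D G \<longleftrightarrow> verts D = vertices G \<and> arcs D = edges G \<and>
     (\<forall>e\<in>edges G. {tail D e, head D e} = ends G e)"

definition is_flow :: "nat \<Rightarrow> ('v, 'e) pre_digraph \<Rightarrow> ('e \<Rightarrow> int) \<Rightarrow> bool" where
  "is_flow k D \<psi> \<longleftrightarrow>
     (\<forall>v\<in>verts D. (\<Sum>z\<in>in_arcs D v. \<psi> z) = (\<Sum>z\<in>out_arcs D v. \<psi> z)) \<and>
     (\<forall>z\<in>arcs D. \<bar>\<psi> z\<bar> \<le> int k - 1)"

definition is_nowhere_zero_flow :: "nat \<Rightarrow> ('v, 'e) pre_digraph \<Rightarrow> ('e \<Rightarrow> int) \<Rightarrow> bool" where
  "is_nowhere_zero_flow k D \<psi> \<longleftrightarrow> is_flow k D \<psi> \<and> (\<forall>z\<in>arcs D. \<psi> z \<noteq> 0)"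

definition has_nowhere_zero_flow :: "nat \<Rightarrow> ('v, 'e) multigraph \<Rightarrow> bool" where
  "has_nowhere_zero_flow k G \<longleftrightarrow> (\<exists>D \<psi>. is_orientation D G \<and> is_nowhere_zero_flow k D \<psi>)"

definition removable :: "nat \<Rightarrow> ('v, 'e) multigraph \<Rightarrow> 'e set \<Rightarrow> bool" where
  "removable k G R \<longleftrightarrow> R \<subseteq> edges G \<and> has_nowhere_zero_flow k (delete_edges G R)"

end

theory Submission
  imports Defs
begin

text \<open>
  The edges of odd value of an integer flow form an even subgraph, which by an Eulerian
  orientation carries a flow with values \<open>\<plusminus>1\<close>. Applied to a nowhere-zero 4-flow \<open>\<psi>\<close>, this gives a
  flow \<open>b\<close> supported on the odd edges of \<open>\<psi>\<close>; applied to \<open>(\<psi> + b) / 2\<close>, a flow \<open>a\<close> whose support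
  contains all edges outside that of \<open>b\<close>; applied to \<open>a + b\<close>, a flow \<open>c\<close>. Every edge is a zero of
  exactly one of \<open>a\<close>, \<open>b\<close>, \<open>c\<close>, hence of exactly one of the six flows \<open>a \<plusminus> b\<close>, \<open>a \<plusminus> c\<close>, \<open>b \<plusminus> c\<close>,
  whose values have modulus at most 2. So one of these flows vanishes on at most a sixth of
  the edges.
\<close>

text \<open>Tail and head maps and the edge set are separate arguments, so that edges can be
  rerouted or discarded. A loop has coefficient 0; for \<open>f = 1\<close> the parity at
  \<open>v\<close> is that of the degree.\<close>

definition net_inflow ::
  "('e \<Rightarrow> 'v) \<Rightarrow> ('e \<Rightarrow> 'v) \<Rightarrow> 'e set \<Rightarrow> ('e \<Rightarrow> int) \<Rightarrow> 'v \<Rightarrow> int" where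
  "net_inflow t h X f v = (\<Sum>e\<in>X. f e * (of_bool (h e = v) - of_bool (t e = v)))"

lemma net_inflow_add:
  "net_inflow t h X (\<lambda>e. f e + g e) v = net_inflow t h X f v + net_inflow t h X g v"
  by (simp add: net_inflow_def sum.distrib distrib_right)

lemma net_inflow_diff:
  "net_inflow t h X (\<lambda>e. f e - g e) v = net_inflow t h X f v - net_inflow t h X g v"
  by (simp add: net_inflow_def sum_subtractf left_diff_distrib)

lemma net_inflow_scale:
  "net_inflow t h X (\<lambda>e. c * f e) v = c * net_inflow t h X f v"
  by (simp add: net_inflow_def sum_distrib_left mult.assoc)

lemma net_inflow_eq_sums:
  assumes "finite X"
  shows "net_inflow t h X f v = sum f {e \<in> X. h e = v} - sum f {e \<in> X. t e = v}"
  using assms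
  by (simp add: net_inflow_def right_diff_distrib sum_subtractf sum.inter_filter of_bool_def
      if_distrib[of "(*) _"] cong: if_cong)

text \<open>
  Induction on the number of edges by splitting off: a non-loop edge \<open>e\<close> into \<open>v\<close> is merged with
  another edge \<open>e'\<close> at \<open>v\<close>, the end \<open>v\<close> of \<open>e'\<close> being moved to the tail of \<open>e\<close>.
\<close>

lemma even_graph_has_unit_flow:
  fixes t h :: "'e \<Rightarrow> 'v"
  assumes "finite X" and "\<And>v. even (net_inflow t h X (\<lambda>_. 1) v)"
  shows "\<exists>f. (\<forall>e\<in>X. f e = 1 \<or> f e = -1) \<and> (\<forall>v. net_inflow t h X f v = 0)"
  using assms
proof (induction X arbitrary: t h rule: finite_induct)
  case empty
  then show ?case by (simp add: net_inflow_def)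
next
  case (insert e X)
  have split: "net_inflow t h (insert e X) f v
      = f e * (of_bool (h e = v) - of_bool (t e = v)) + net_inflow t h X f v" for f v
    using insert.hyps by (simp add: net_inflow_def)
  show ?case
  proof (cases "t e = h e")
    case True
    then have "even (net_inflow t h X (\<lambda>_. 1) v)" for v
      using insert.prems[of v] by (simp add: split)
    then obtain f where f: "\<forall>e\<in>X. f e = 1 \<or> f e = -1" "\<forall>v. net_inflow t h X f v = 0"
      using insert.IH by blast
    define f' where "f' = f(e := 1)"
    have "net_inflow t h X f' v = net_inflow t h X f v" for v
      unfolding net_inflow_def f'_def using insert.hyps by (intro sum.cong) auto
    then have "net_inflow t h (insert e X) f' v = 0" for v
      using f True by (simp add: split)
    moreover have "\<forall>a\<in>insert e X. f' a = 1 \<or> f' a = -1"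
      using f by (simp add: f'_def)
    ultimately show ?thesis by blast
  next
    case False
    \<comment> \<open>The edge \<open>e\<close> contributes 1 at its head, so the edges of
      \<open>X\<close> have odd net inflow there and one of them has a nonzero coefficient.\<close>
    have "odd (net_inflow t h X (\<lambda>_. 1) (h e))"
      using insert.prems[of "h e"] False by (simp add: split)
    then have "\<exists>e'\<in>X. of_bool (h e' = h e) - of_bool (t e' = h e) \<noteq> (0::int)"
      unfolding net_inflow_def by (metis (no_types, lifting) even_zero mult_1 sum.neutral)
    then obtain e' where e': "e' \<in> X" "h e' = h e \<or> t e' = h e"
      by (auto simp: of_bool_def split: if_splits)
    \<comment> \<open>\<open>s\<close> records whether \<open>e\<close> and \<open>e'\<close> are traversed in the same direction.\<close>
    obtain t' h' and s :: int where
      s: "s = 1 \<or> s = -1" and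
      other: "\<And>a. a \<noteq> e' \<Longrightarrow> t' a = t a \<and> h' a = h a" and
      merged: "\<And>v. of_bool (h' e' = v) - of_bool (t' e' = v)
        = of_bool (h e' = v) - of_bool (t e' = v)
          + s * (of_bool (h e = v) - of_bool (t e = v))"
    proof (cases "t e' = h e")
      case True
      then show ?thesis
        by (intro that[of 1 "t(e' := t e)" h]) auto
    next
      case False
      with e' show ?thesis
        by (intro that[of "-1" t "h(e' := t e)"]) auto
    qed
    have merge: "net_inflow t' h' X f v
        = net_inflow t h X f v + f e' * s * (of_bool (h e = v) - of_bool (t e = v))" for f v
    proof -
      have "net_inflow t' h' X f v = f e' * (of_bool (h' e' = v) - of_bool (t' e' = v))
          + (\<Sum>a\<in>X - {e'}. f a * (of_bool (h' a = v) - of_bool (t' a = v)))"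
        unfolding net_inflow_def using insert.hyps e' by (simp add: sum.remove)
      also have "(\<Sum>a\<in>X - {e'}. f a * (of_bool (h' a = v) - of_bool (t' a = v)))
          = (\<Sum>a\<in>X - {e'}. f a * (of_bool (h a = v) - of_bool (t a = v)))"
        using other by (intro sum.cong) auto
      also have "\<dots> = net_inflow t h X f v - f e' * (of_bool (h e' = v) - of_bool (t e' = v))"
        unfolding net_inflow_def using insert.hyps e' by (simp add: sum.remove)
      finally show ?thesis
        by (simp add: merged algebra_simps)
    qed
    \<comment> \<open>Since \<open>s\<close> is 1 or -1, merging changes the total for weight 1 by 0
      or by twice the coefficient of \<open>e\<close>.\<close>
    have "even (net_inflow t' h' X (\<lambda>_. 1) v)" for v
      using insert.prems[of v] s by (auto simp: split merge)
    then obtain f where f: "\<forall>e\<in>X. f e = 1 \<or> f e = -1" "\<forall>v. net_inflow t' h' X f v = 0"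
      using insert.IH by blast
    \<comment> \<open>With this value, the contribution of \<open>e\<close> is exactly the
      correction term in \<open>merge\<close>.\<close>
    define f' where "f' = f(e := s * f e')"
    have "net_inflow t h X f' v = net_inflow t h X f v" for v
      unfolding net_inflow_def f'_def using insert.hyps by (intro sum.cong) auto
    then have "net_inflow t h (insert e X) f' v = net_inflow t' h' X f v" for v
      by (simp add: split merge f'_def)
    moreover have "\<forall>a\<in>insert e X. f' a = 1 \<or> f' a = -1"
      using f s e' by (auto simp: f'_def)
    ultimately show ?thesis using f by auto
  qed
qed

text \<open>Modulo 2, \<open>g\<close> is the indicator of its odd edges, so these form an even
  subgraph; its unit flow is extended by 0.\<close>

lemma unit_flow_on_odd_edges:
  assumes "finite X" and "\<And>v. net_inflow t h X g v = 0"
  obtains f where "\<And>v. net_inflow t h X f v = 0"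
    and "\<And>e. e \<in> X \<Longrightarrow> f e = 1 \<or> f e = 0 \<or> f e = -1"
    and "\<And>e. e \<in> X \<Longrightarrow> f e = 0 \<longleftrightarrow> even (g e)"
proof -
  let ?Y = "{e \<in> X. odd (g e)}"
  have restrict: "net_inflow t h ?Y f v = net_inflow t h X (\<lambda>e. if odd (g e) then f e else 0) v"
    for f v
    unfolding net_inflow_def using assms(1)
    by (simp add: sum.inter_filter if_distrib[of "\<lambda>x. x * _"] cong: if_cong)
  have "even (net_inflow t h ?Y (\<lambda>_. 1) v)" for v
  proof -
    \<comment> \<open>The indicator of the odd edges is \<open>g - 2 * (g div 2)\<close>.\<close>
    have "net_inflow t h ?Y (\<lambda>_. 1) v
        = net_inflow t h X g v + net_inflow t h X (\<lambda>e. 2 * (- (g e div 2))) v"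
      unfolding restrict net_inflow_add[symmetric]
      by (rule arg_cong[where f = "\<lambda>f. net_inflow t h X f v"]) (auto simp: fun_eq_iff elim!: oddE)
    then show ?thesis
      by (simp only: assms(2) net_inflow_scale) simp
  qed
  then obtain f where f: "\<forall>e\<in>?Y. f e = 1 \<or> f e = -1" "\<forall>v. net_inflow t h ?Y f v = 0"
    using even_graph_has_unit_flow[of ?Y t h] assms(1) by auto
  show ?thesis
    by (rule that[of "\<lambda>e. if odd (g e) then f e else 0"]) (use f in \<open>auto simp flip: restrict\<close>)
qed

lemma is_flow_iff_net_inflow:
  assumes "finite (arcs D)"
  shows "is_flow k D \<psi> \<longleftrightarrow>
    (\<forall>v\<in>verts D. net_inflow (tail D) (head D) (arcs D) \<psi> v = 0) \<and>
    (\<forall>z\<in>arcs D. \<bar>\<psi> z\<bar> \<le> int k - 1)"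
  using assms by (simp add: is_flow_def in_arcs_def out_arcs_def net_inflow_eq_sums)

lemma removable_zeros_of_flow:
  assumes "finite (edges G)" and "is_orientation D G" and "is_flow k D f"
  shows "removable k G {e \<in> edges G. f e = 0}"
proof -
  let ?R = "{e \<in> edges G. f e = 0}"
  let ?D = "D\<lparr>arcs := arcs D - ?R\<rparr>"
  have arcs: "arcs D = edges G"
    using assms(2) by (simp add: is_orientation_def)
  have "net_inflow (tail D) (head D) (arcs D - ?R) f v
      = net_inflow (tail D) (head D) (arcs D) f v" for v
    unfolding net_inflow_def using assms(1) by (intro sum.mono_neutral_left) (auto simp: arcs)
  then have "is_flow k ?D f"
    using assms(1,3) by (simp add: is_flow_iff_net_inflow arcs)
  then have "is_nowhere_zero_flow k ?D f"
    by (auto simp: is_nowhere_zero_flow_def arcs)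
  moreover have "is_orientation ?D (delete_edges G ?R)"
    using assms(2) by (auto simp: is_orientation_def delete_edges_def)
  ultimately show ?thesis
    unfolding removable_def has_nowhere_zero_flow_def by blast
qed

lemma four_flow_as_three_unit_flows:
  assumes "finite X" and "\<And>v. net_inflow t h X \<psi> v = 0"
    and "\<And>e. e \<in> X \<Longrightarrow> \<bar>\<psi> e\<bar> \<le> 3 \<and> \<psi> e \<noteq> 0"
  obtains a b c where
    "\<And>v. net_inflow t h X a v = 0" "\<And>v. net_inflow t h X b v = 0"
    "\<And>v. net_inflow t h X c v = 0"
    "\<And>e. e \<in> X \<Longrightarrow> \<bar>a e\<bar> \<le> 1 \<and> \<bar>b e\<bar> \<le> 1 \<and> \<bar>c e\<bar> \<le> 1"
    "\<And>e. e \<in> X \<Longrightarrow> of_bool (a e = 0) + of_bool (b e = 0) + of_bool (c e = 0) = (1::nat)"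
proof -
  obtain b where b: "\<And>v. net_inflow t h X b v = 0"
      "\<And>e. e \<in> X \<Longrightarrow> b e = 1 \<or> b e = 0 \<or> b e = -1"
      "\<And>e. e \<in> X \<Longrightarrow> b e = 0 \<longleftrightarrow> even (\<psi> e)"
    using unit_flow_on_odd_edges[of X t h \<psi>] assms by blast
  \<comment> \<open>The division is exact on \<open>X\<close>, because \<open>b\<close> and
    \<open>\<psi>\<close> have the same parity there.\<close>
  define g where "g = (\<lambda>e. (\<psi> e + b e) div 2)"
  have g: "\<psi> e + b e = 2 * g e" if "e \<in> X" for e
    using b(2,3)[OF that] unfolding g_def by presburger
  have "net_inflow t h X g v = 0" for v
  proof -
    have "2 * net_inflow t h X g v = net_inflow t h X (\<lambda>e. \<psi> e + b e) v"
      unfolding net_inflow_scale[symmetric] unfolding net_inflow_def using g by simp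
    then show ?thesis by (simp add: net_inflow_add assms(2) b)
  qed
  then obtain a where a: "\<And>v. net_inflow t h X a v = 0"
      "\<And>e. e \<in> X \<Longrightarrow> a e = 1 \<or> a e = 0 \<or> a e = -1"
      "\<And>e. e \<in> X \<Longrightarrow> a e = 0 \<longleftrightarrow> even (g e)"
    using unit_flow_on_odd_edges[of X t h g] assms(1) by blast
  \<comment> \<open>Once \<open>a\<close> and \<open>b\<close> are known never to vanish together,
    \<open>a + b\<close> is odd exactly where one of them vanishes, so \<open>c\<close> vanishes
    exactly where neither does.\<close>
  have "net_inflow t h X (\<lambda>e. a e + b e) v = 0" for v
    by (simp add: net_inflow_add a b)
  then obtain c where c: "\<And>v. net_inflow t h X c v = 0"
      "\<And>e. e \<in> X \<Longrightarrow> c e = 1 \<or> c e = 0 \<or> c e = -1"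
      "\<And>e. e \<in> X \<Longrightarrow> c e = 0 \<longleftrightarrow> even (a e + b e)"
    using unit_flow_on_odd_edges[of X t h "\<lambda>e. a e + b e"] assms(1) by blast
  \<comment> \<open>A common zero would make \<open>\<psi> e\<close> a multiple of 4, against
    \<open>0 < \<bar>\<psi> e\<bar> \<le> 3\<close>.\<close>
  have cover: "a e \<noteq> 0 \<or> b e \<noteq> 0" if e: "e \<in> X" for e
  proof (rule ccontr)
    assume "\<not> ?thesis"
    then have "even (g e)" "\<psi> e = 2 * g e"
      using a(3)[OF e] g[OF e] by auto
    then show False
      using assms(3)[OF e] by presburger
  qed
  show ?thesis
  proof (rule that[of a b c])
    fix e assume e: "e \<in> X"
    show "\<bar>a e\<bar> \<le> 1 \<and> \<bar>b e\<bar> \<le> 1 \<and> \<bar>c e\<bar> \<le> 1"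
      using a(2)[OF e] b(2)[OF e] c(2)[OF e] by auto
    show "of_bool (a e = 0) + of_bool (b e = 0) + of_bool (c e = 0) = (1::nat)"
      using a(2)[OF e] b(2)[OF e] c(3)[OF e] cover[OF e] by auto
  qed (fact a(1) b(1) c(1))+
qed

lemma pigeonhole_sum_list:
  fixes n :: "'a \<Rightarrow> nat"
  assumes "xs \<noteq> []"
  shows "\<exists>x\<in>set xs. length xs * n x \<le> (\<Sum>x\<leftarrow>xs. n x)"
proof -
  obtain x where x: "x \<in> set xs" "\<And>y. y \<in> set xs \<Longrightarrow> n x \<le> n y"
    using ex_has_least_nat[of "\<lambda>x. x \<in> set xs" _ n] assms by (metis list.set_sel(1))
  then have "(\<Sum>y\<leftarrow>xs. n x) \<le> (\<Sum>y\<leftarrow>xs. n y)"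
    by (intro sum_list_mono)
  with x(1) show ?thesis
    by (auto simp: sum_list_triv)
qed

theorem theorem1p2:
  fixes G :: "('v, 'e) multigraph"
  assumes "finite_multigraph G"
    and "has_nowhere_zero_flow 4 G"
  shows "\<exists>R. R \<subseteq> edges G \<and> removable 3 G R \<and> real (card R) \<le> 1 / 6 * real (card (edges G))"
proof -
  note finite_edges = finite_multigraph.finite_edges[OF assms(1)]
    and ends_in_vertices = finite_multigraph.ends_in_vertices[OF assms(1)]
  let ?E = "edges G"
  obtain D \<psi> where D: "is_orientation D G" and \<psi>: "is_nowhere_zero_flow 4 D \<psi>"
    using assms(2) by (auto simp: has_nowhere_zero_flow_def)
  have arcs: "arcs D = ?E" and verts: "verts D = vertices G"
    using D by (auto simp: is_orientation_def)
  let ?net = "net_inflow (tail D) (head D) ?E"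
  \<comment> \<open>Conservation is required at every \<open>v\<close> of the type; outside the
    graph it holds because no edge is incident with \<open>v\<close>.\<close>
  have "?net \<psi> v = 0" for v
  proof (cases "v \<in> vertices G")
    case True
    then show ?thesis
      using \<psi> finite_edges
      by (simp add: is_nowhere_zero_flow_def is_flow_iff_net_inflow arcs verts)
  next
    case False
    then have "\<forall>e\<in>?E. head D e \<noteq> v \<and> tail D e \<noteq> v"
      using D ends_in_vertices by (fastforce simp: is_orientation_def)
    then show ?thesis by (simp add: net_inflow_def)
  qed
  moreover have "\<bar>\<psi> e\<bar> \<le> 3 \<and> \<psi> e \<noteq> 0" if "e \<in> ?E" for e
    using \<psi> that by (auto simp: is_nowhere_zero_flow_def is_flow_def arcs)
  ultimately obtain a b c where
    flow: "\<And>v. ?net a v = 0" "\<And>v. ?net b v = 0" "\<And>v. ?net c v = 0" and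
    bound: "\<And>e. e \<in> ?E \<Longrightarrow> \<bar>a e\<bar> \<le> 1 \<and> \<bar>b e\<bar> \<le> 1 \<and> \<bar>c e\<bar> \<le> 1" and
    zero: "\<And>e. e \<in> ?E \<Longrightarrow> of_bool (a e = 0) + of_bool (b e = 0) + of_bool (c e = 0) = (1::nat)"
    using four_flow_as_three_unit_flows[of ?E "tail D" "head D" \<psi>] finite_edges by blast
  let ?Z = "\<lambda>f. {e \<in> ?E. f e = (0::int)}"
  have removable_zeros: "removable 3 G (?Z f)"
    if "\<And>v. ?net f v = 0" "\<And>e. e \<in> ?E \<Longrightarrow> \<bar>f e\<bar> \<le> 2" for f
    using removable_zeros_of_flow[OF finite_edges D, of 3 f] that finite_edges
    by (simp add: is_flow_iff_net_inflow arcs)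
  \<comment> \<open>A list counts with multiplicity: the six functions may coincide, for instance
    when \<open>b\<close> is zero.\<close>
  define F where "F = [\<lambda>e. a e + b e, \<lambda>e. a e - b e, \<lambda>e. a e + c e, \<lambda>e. a e - c e,
    \<lambda>e. b e + c e, \<lambda>e. b e - c e]"
  have length_F: "length F = 6" "F \<noteq> []"
    by (simp_all add: F_def)
  have removable_F: "removable 3 G (?Z f)" if "f \<in> set F" for f
    using that unfolding F_def
    by (auto intro!: removable_zeros simp: net_inflow_add net_inflow_diff flow dest!: bound)
  have "(\<Sum>f\<leftarrow>F. card (?Z f)) = (\<Sum>f\<leftarrow>F. \<Sum>e\<in>?E. of_bool (f e = 0))"
    using finite_edges by (simp add: Int_def)
  also have "\<dots> = (\<Sum>e\<in>?E. \<Sum>f\<leftarrow>F. of_bool (f e = 0))"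
    by (simp add: F_def sum.distrib)
  also have "\<dots> = (\<Sum>e\<in>?E. 1)"
  proof (rule sum.cong)
    fix e assume e: "e \<in> ?E"
    \<comment> \<open>For nonzero \<open>x\<close> and \<open>y\<close> in {-1, 1}, exactly one of
      \<open>x + y\<close> and \<open>x - y\<close> vanishes; if just one of \<open>x\<close>,
      \<open>y\<close> is zero, neither does. By \<open>zero\<close>, exactly one of the three pairs
      at \<open>e\<close> has both values nonzero.\<close>
    have pair: "of_bool (x + y = 0) + of_bool (x - y = 0)
        = of_bool (x \<noteq> 0 \<and> y \<noteq> 0) + 2 * (of_bool (x = 0 \<and> y = 0) :: nat)"
      if "\<bar>x\<bar> \<le> 1" "\<bar>y\<bar> \<le> 1" for x y :: int
      using that by (cases "x = 0"; cases "y = 0") (auto simp: of_bool_def)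
    have "(\<Sum>f\<leftarrow>F. of_bool (f e = 0))
        = (of_bool (a e + b e = 0) + of_bool (a e - b e = 0))
        + (of_bool (a e + c e = 0) + of_bool (a e - c e = 0))
        + (of_bool (b e + c e = 0) + of_bool (b e - c e = (0::int)) :: nat)"
      unfolding F_def by (simp only: list.map sum_list.Cons sum_list.Nil add.assoc add_0_right)
    also have "\<dots> = 1"
      using zero[OF e] bound[OF e]
      by (cases "a e = 0"; cases "b e = 0"; cases "c e = 0") (simp_all only: pair, simp_all)
    finally show "(\<Sum>f\<leftarrow>F. of_bool (f e = 0)) = (1::nat)" .
  qed simp
  finally have "(\<Sum>f\<leftarrow>F. card (?Z f)) = card ?E"
    by simp
  then have "\<exists>f\<in>set F. 6 * card (?Z f) \<le> card ?E"
    using pigeonhole_sum_list[of F "\<lambda>f. card (?Z f)"] length_F by force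
  then obtain f where "f \<in> set F" "6 * card (?Z f) \<le> card ?E"
    by blast
  then show ?thesis
    by (intro exI[of _ "?Z f"]) (auto intro: removable_F)
qed

end
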